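(* Let $\mathcal F$ be a duplicate detection filter type and let $\mathcal Q$ be the queuing filter built from $L$ subfilters of type $\mathcal F$ with capacity $c$, used over a sliding window of size $w=cL$, on a stream of elements drawn independently and uniformly from an alphabet $\Gamma$. Let $\mathrm{FN}^w_{\mathcal Q,m}$ be the false negative probability of $\mathcal Q$ after $m>w$ insertions. For $\eta\geq 0$ let $\mathrm{FN}_{\mathcal F,\eta}$ and $\mathrm{FP}_{\mathcal F,\eta}$ be the false negative and false positive probabilities of a subfilter of type $\mathcal F$ after $\eta$ insertions, let $$p_\eta=\frac{1-\left(1-\frac{1}{|\Gamma|}\right)^{\eta}}{1-\left(1-\frac{1}{|\Gamma|}\right)^{w}},$$ and $u_\eta = p_\eta\,\mathrm{FN}_{\mathcal F,\eta}+(1-p_\eta)(1-\mathrm{FP}_{\mathcal F,\eta})$. Then $$\mathrm{FN}^w_{\mathcal Q,m} = u_c^{L-1}\,u_{m\bmod c}.$$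
   Context: A duplicate detection filter (DDF) processes a stream of elements of $\Gamma$; for each new element it answers $\mathrm{DUPLICATE}$ or $\mathrm{UNSEEN}$ (lookup) and then inserts it. For a (non-windowed) subfilter after $\eta$ insertions, the false positive probability is the probability that an element not among the inserted ones is answered $\mathrm{DUPLICATE}$, and the false negative probability is the probability that an element among the inserted ones is answered $\mathrm{UNSEEN}$. Queuing filter: $\mathcal Q$ maintains a FIFO queue of $L$ instances (subfilters) of $\mathcal F$. Each new element is inserted only into the newest subfilter; after every $c$ insertions, the oldest subfilter is discarded and a new empty subfilter is pushed at the front. The elements inserted into a given subfilter form its sub-sliding window. Lookup of $e$ returns $\mathrm{DUPLICATE}$ iff at least one subfilter's lookup does. Over the sliding window $w$, an element arriving after $e_1,\dots,e_m$ is a duplicate if it belongs to $\{e_{m-w+1},\dots,e_m\}$; a false negative of $\mathcal Q$ is a duplicate answered $\mathrm{UNSEEN}$; answers of distinct subfilters are treated as independent events. *)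

theory Defs
  imports "HOL-Probability.Probability"
begin

datatype answer = DUPLICATE | UNSEEN

text \<open>A duplicate detection filter on elements of type \<open>'a\<close> with memory states of type \<open>'s\<close>.
  All three components may be randomised; a deterministic one is a \<^const>\<open>return_pmf\<close>.
  Anything drawn once per instance (e.g. hash functions) is part of the state.\<close>

datatype ('a, 's) ddf =
  DDF (ddf_empty: "'s pmf")
      (ddf_insert: "'a \<Rightarrow> 's \<Rightarrow> 's pmf")
      (ddf_lookup: "'a \<Rightarrow> 's \<Rightarrow> answer pmf")

primrec ddf_inserts :: "('a, 's) ddf \<Rightarrow> 'a list \<Rightarrow> 's \<Rightarrow> 's pmf" where
  "ddf_inserts F [] s = return_pmf s"
| "ddf_inserts F (x # xs) s = bind_pmf (ddf_insert F x s) (ddf_inserts F xs)"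

definition ddf_state :: "('a, 's) ddf \<Rightarrow> 'a list \<Rightarrow> 's pmf" where
  "ddf_state F es = bind_pmf (ddf_empty F) (ddf_inserts F es)"

text \<open>The experiment underlying the error probabilities: \<open>n\<close> independent uniform elements
  \<open>es = [e\<^sub>1, \<dots>, e\<^sub>n]\<close> are inserted, then the next stream element \<open>e\<close> is looked up.\<close>

definition ddf_trial :: "('a, 's) ddf \<Rightarrow> 'a set \<Rightarrow> nat \<Rightarrow> ('a list \<times> 'a \<times> answer) pmf" where
  "ddf_trial F \<Gamma> n = do {
     es \<leftarrow> replicate_pmf n (pmf_of_set \<Gamma>);
     e \<leftarrow> pmf_of_set \<Gamma>;
     s \<leftarrow> ddf_state F es;
     a \<leftarrow> ddf_lookup F e s;
     return_pmf (es, e, a)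
   }"

definition FN :: "('a, 's) ddf \<Rightarrow> 'a set \<Rightarrow> nat \<Rightarrow> real" where
  "FN F \<Gamma> \<eta> = cond_prob (measure_pmf (ddf_trial F \<Gamma> \<eta>))
     (\<lambda>(es, e, a). a = UNSEEN) (\<lambda>(es, e, a). e \<in> set es)"

definition FP :: "('a, 's) ddf \<Rightarrow> 'a set \<Rightarrow> nat \<Rightarrow> real" where
  "FP F \<Gamma> \<eta> = cond_prob (measure_pmf (ddf_trial F \<Gamma> \<eta>))
     (\<lambda>(es, e, a). a = DUPLICATE) (\<lambda>(es, e, a). e \<notin> set es)"

definition window_duplicate :: "nat \<Rightarrow> 'a list \<Rightarrow> 'a \<Rightarrow> bool" where
  "window_duplicate w es e \<longleftrightarrow> e \<in> set (drop (length es - w) es)"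

definition FN_window :: "('a, 's) ddf \<Rightarrow> 'a set \<Rightarrow> nat \<Rightarrow> nat \<Rightarrow> real" where
  "FN_window F \<Gamma> w m = cond_prob (measure_pmf (ddf_trial F \<Gamma> m))
     (\<lambda>(es, e, a). a = UNSEEN) (\<lambda>(es, e, a). window_duplicate w es e)"

text \<open>A state of the queuing filter is \<open>(k, qs)\<close>, where \<open>qs\<close> lists the subfilters from the newest
  to the oldest and \<open>k < c\<close> counts the insertions into the newest one.\<close>

primrec queue_lookups :: "('a, 's) ddf \<Rightarrow> 'a \<Rightarrow> 's list \<Rightarrow> answer list pmf" where
  "queue_lookups F e [] = return_pmf []"
| "queue_lookups F e (q # qs) = do {
     a \<leftarrow> ddf_lookup F e q;
     as \<leftarrow> queue_lookups F e qs;
     return_pmf (a # as)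
   }"

definition queue_insert ::
    "('a, 's) ddf \<Rightarrow> nat \<Rightarrow> 'a \<Rightarrow> nat \<times> 's list \<Rightarrow> (nat \<times> 's list) pmf" where
  "queue_insert F c e = (\<lambda>(k, qs). do {
     q \<leftarrow> ddf_insert F e (hd qs);
     if Suc k = c
     then do {
       fresh \<leftarrow> ddf_empty F;
       return_pmf (0, fresh # butlast (q # tl qs))
     }
     else return_pmf (Suc k, q # tl qs)
   })"

definition queuing_filter ::
    "('a, 's) ddf \<Rightarrow> nat \<Rightarrow> nat \<Rightarrow> ('a, nat \<times> 's list) ddf" where
  "queuing_filter F L c = DDF
     (map_pmf (Pair 0) (replicate_pmf L (ddf_empty F)))
     (queue_insert F c)
     (\<lambda>e (k, qs). map_pmf (\<lambda>as. if DUPLICATE \<in> set as then DUPLICATE else UNSEEN)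
        (queue_lookups F e qs))"

text \<open>The same experiment as \<^const>\<open>ddf_trial\<close> for the queuing filter, but recording the
  individual answers of the subfilters.\<close>

definition queue_trial ::
    "('a, 's) ddf \<Rightarrow> nat \<Rightarrow> nat \<Rightarrow> 'a set \<Rightarrow> nat \<Rightarrow> ('a list \<times> 'a \<times> answer list) pmf" where
  "queue_trial F L c \<Gamma> m = do {
     es \<leftarrow> replicate_pmf m (pmf_of_set \<Gamma>);
     e \<leftarrow> pmf_of_set \<Gamma>;
     (k, qs) \<leftarrow> ddf_state (queuing_filter F L c) es;
     as \<leftarrow> queue_lookups F e qs;
     return_pmf (es, e, as)
   }"

text \<open>The answers of distinct subfilters to a duplicate are independent, i.e. the events that the
  \<open>i\<close>-th subfilter answers \<^const>\<open>UNSEEN\<close> are (mutually) independent conditionally on the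
  queried element being a duplicate over the window \<open>w\<close>. The conditioning event is the one
  in \<^const>\<open>FN_window\<close>.\<close>

definition independent_answers ::
    "('a, 's) ddf \<Rightarrow> nat \<Rightarrow> nat \<Rightarrow> 'a set \<Rightarrow> nat \<Rightarrow> nat \<Rightarrow> bool" where
  "independent_answers F L c \<Gamma> w m \<longleftrightarrow>
     prob_space.indep_events
       (measure_pmf (cond_pmf (queue_trial F L c \<Gamma> m) {(es, e, as). window_duplicate w es e}))
       (\<lambda>i. {(es, e, as). as ! i = UNSEEN}) {..<L}"

definition p_sub :: "'a set \<Rightarrow> nat \<Rightarrow> nat \<Rightarrow> real" where
  "p_sub \<Gamma> w \<eta> = (1 - (1 - 1 / real (card \<Gamma>)) ^ \<eta>) / (1 - (1 - 1 / real (card \<Gamma>)) ^ w)"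

definition u_sub :: "('a, 's) ddf \<Rightarrow> 'a set \<Rightarrow> nat \<Rightarrow> nat \<Rightarrow> real" where
  "u_sub F \<Gamma> w \<eta> = p_sub \<Gamma> w \<eta> * FN F \<Gamma> \<eta> + (1 - p_sub \<Gamma> w \<eta>) * (1 - FP F \<Gamma> \<eta>)"

end

theory Submission
  imports Defs
begin

text \<open>
  After \<open>m > w\<close> insertions the \<open>i\<close>-th newest subfilter is distributed like a single filter fed with a
  block of \<open>\<eta>\<close> consecutive stream elements inside the window, where \<open>\<eta> = m mod c\<close> for the newest
  subfilter and \<open>\<eta> = c\<close> for the others. Given the block and the query \<open>e\<close>, the other \<open>w - \<eta>\<close> window
  elements contain \<open>e\<close> with probability \<open>1 - (1 - 1/|\<Gamma>|)^(w - \<eta>)\<close>. This value depends neither on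
  the block nor on \<open>e\<close>, so this event is an independent coin flip, and \<open>e\<close> is a duplicate iff it lies
  in the block or the coin shows heads. Conditioning on being a duplicate then gives \<open>u\<^sub>\<eta>\<close> as the
  probability that the subfilter answers UNSEEN, and the assumed independence multiplies these.
\<close>

section \<open>Independent draws from a list of distributions\<close>

text \<open>Generalises \<open>replicate_pmf\<close> to non-identical factors, since the subfilters
  of the queue hold different blocks and so have different laws.\<close>

primrec seq_pmf :: "'b pmf list \<Rightarrow> 'b list pmf" where
  "seq_pmf [] = return_pmf []"
| "seq_pmf (p # ps) = do {x \<leftarrow> p; xs \<leftarrow> seq_pmf ps; return_pmf (x # xs)}"

lemma seq_pmf_replicate: "seq_pmf (replicate n p) = replicate_pmf n p"
  by (induction n) simp_all

lemma length_seq_pmf: "xs \<in> set_pmf (seq_pmf ps) \<Longrightarrow> length xs = length ps"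
  by (induction ps arbitrary: xs) auto

lemma nth_seq_pmf: "i < length ps \<Longrightarrow> map_pmf (\<lambda>xs. xs ! i) (seq_pmf ps) = ps ! i"
proof (induction ps arbitrary: i)
  case (Cons p ps)
  show ?case
  proof (cases i)
    case 0
    then show ?thesis
      by (simp add: map_bind_pmf bind_return_pmf')
  next
    case (Suc j)
    then have "map_pmf (\<lambda>xs. xs ! j) (seq_pmf ps) = ps ! j"
      using Cons by simp
    then show ?thesis
      using Suc by (simp add: map_bind_pmf) (simp add: map_pmf_def)
  qed
qed simp

text \<open>Forgetting the last factor of a product integrates it out. This models the discarding of
  the oldest subfilter.\<close>

lemma butlast_seq_pmf: "map_pmf butlast (seq_pmf ps) = seq_pmf (butlast ps)"
proof (induction ps)
  case (Cons p ps)
  show ?case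
  proof (cases "ps = []")
    case True
    then show ?thesis by (simp add: map_bind_pmf bind_return_pmf)
  next
    case False
    have "butlast (x # xs) = x # butlast xs" if "xs \<in> set_pmf (seq_pmf ps)" for x and xs :: "'a list"
      using length_seq_pmf[OF that] False by auto
    then have "map_pmf butlast (seq_pmf (p # ps))
        = do {x \<leftarrow> p; xs \<leftarrow> map_pmf butlast (seq_pmf ps); return_pmf (x # xs)}"
      by (auto simp: map_bind_pmf bind_map_pmf intro!: bind_pmf_cong)
    also have "\<dots> = seq_pmf (butlast (p # ps))"
      using Cons False by simp
    finally show ?thesis .
  qed
qed simp

text \<open>Independent draws commute, so each second-stage draw can be moved next to the draw it
  depends on. This fuses the state of a subfilter with its lookup.\<close>

lemma bind_seq_pmf:
  "bind_pmf (seq_pmf ps) (\<lambda>xs. seq_pmf (map f xs)) = seq_pmf (map (\<lambda>p. bind_pmf p f) ps)"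
proof (induction ps)
  case (Cons p ps)
  have "bind_pmf (seq_pmf (p # ps)) (\<lambda>xs. seq_pmf (map f xs))
      = do {x \<leftarrow> p; y \<leftarrow> f x; ys \<leftarrow> bind_pmf (seq_pmf ps) (\<lambda>xs. seq_pmf (map f xs));
          return_pmf (y # ys)}"
    by (simp add: bind_assoc_pmf bind_return_pmf) (subst bind_commute_pmf, rule refl)
  then show ?case
    by (simp add: Cons bind_assoc_pmf)
qed (simp add: bind_return_pmf)

lemma queue_lookups_eq: "queue_lookups F e qs = seq_pmf (map (ddf_lookup F e) qs)"
  by (induction qs) simp_all

section \<open>Filter states and the contents of the subfilters\<close>

lemma ddf_inserts_Nil: "ddf_inserts F [] = return_pmf"
  by (rule ext) simp

lemma ddf_inserts_snoc:
  "ddf_inserts F (es @ [e]) = (\<lambda>s. bind_pmf (ddf_inserts F es s) (ddf_insert F e))"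
proof (induction es)
  case Nil
  show ?case
    by (rule ext) (simp add: ddf_inserts_Nil bind_return_pmf bind_return_pmf')
next
  case (Cons x es)
  then show ?case
    by (intro ext) (simp add: bind_assoc_pmf)
qed

lemma ddf_state_snoc:
  "ddf_state F (es @ [e]) = bind_pmf (ddf_state F es) (ddf_insert F e)"
  by (simp add: ddf_state_def ddf_inserts_snoc bind_assoc_pmf)

lemma ddf_state_Nil: "ddf_state F [] = ddf_empty F"
  by (simp add: ddf_state_def ddf_inserts_Nil bind_return_pmf')

text \<open>The elements held by the \<open>i\<close>-th newest subfilter; for \<open>i = 0\<close> only \<open>length es mod c\<close> of
  them are left to take.\<close>

definition block :: "nat \<Rightarrow> 'a list \<Rightarrow> nat \<Rightarrow> 'a list" where
  "block c es i = (if i \<le> length es div c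
     then take c (drop ((length es div c - i) * c) es) else [])"

lemma block_eq:
  assumes "length es = d * c + r" "r < c"
  shows "block c es i = (if i \<le> d then take c (drop ((d - i) * c) es) else [])"
proof -
  have "length es div c = d"
    using assms by simp
  then show ?thesis
    by (simp add: block_def)
qed

text \<open>A block with index \<open>i > 0\<close> is complete: it ends at or before position
  \<open>d * c\<close>, so an appended element cannot reach it.\<close>

lemma earlier_block_snoc:
  assumes "length es = d * c + r" "0 < i" "i \<le> d"
  shows "take c (drop ((d - i) * c) (es @ [e])) = take c (drop ((d - i) * c) es)"
proof -
  have "(d - i) * c + c = Suc (d - i) * c"
    by simp
  also have "\<dots> \<le> d * c"
    using assms by (intro mult_right_mono) auto
  finally have "(d - i) * c + c \<le> length es"
    using assms(1) by linarith
  then show ?thesis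
    by simp
qed

text \<open>The new element completes the newest block and raises \<open>length es div c\<close> by
  one, so all blocks age by one index and an empty one appears in front.\<close>

lemma block_snoc_full:
  assumes "Suc (length es mod c) = c"
  shows "block c (es @ [e]) 0 = []"
    and "block c (es @ [e]) (Suc i) = (if i = 0 then block c es 0 @ [e] else block c es i)"
proof -
  define d r where "d = length es div c" and "r = length es mod c"
  have len: "length es = d * c + r" and r: "Suc r = c" "r < c"
    using assms by (auto simp: d_def r_def)
  have "length (es @ [e]) = Suc d * c + 0" "0 < c"
    using len r by auto
  note eqs = block_eq[OF len r(2)] block_eq[OF this]
  show "block c (es @ [e]) 0 = []"
    using len r(1) by (auto simp: eqs(2))
  show "block c (es @ [e]) (Suc i) = (if i = 0 then block c es 0 @ [e] else block c es i)"
  proof (cases "i = 0")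
    case True
    then show ?thesis
      using len r(1) by (auto simp: eqs)
  next
    case False
    then show ?thesis
      using earlier_block_snoc[OF len, of i e] by (simp add: eqs)
  qed
qed

text \<open>Here the quotient \<open>length es div c\<close> stays the same, so no index shifts and
  only the newest block grows.\<close>

lemma block_snoc:
  assumes "Suc (length es mod c) < c"
  shows "block c (es @ [e]) i = (if i = 0 then block c es 0 @ [e] else block c es i)"
proof -
  define d r where "d = length es div c" and "r = length es mod c"
  have len: "length es = d * c + r" and r: "Suc r < c" "r < c"
    using assms by (auto simp: d_def r_def)
  have "length (es @ [e]) = d * c + Suc r"
    using len by simp
  note eqs = block_eq[OF len r(2)] block_eq[OF this r(1)]
  show ?thesis
  proof (cases "i = 0")
    case True
    then show ?thesis
      using len r by (simp add: eqs)
  next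
    case False
    then show ?thesis
      using earlier_block_snoc[OF len, of i e] by (simp add: eqs)
  qed
qed

text \<open>Insertion preserves the product form: it acts on the head alone and commutes with
  drawing the tail. The fresh subfilter is the state of the empty block.\<close>

lemma queue_insert_seq_pmf:
  "bind_pmf (seq_pmf (map (ddf_state F) (b # bs))) (\<lambda>qs. queue_insert F c e (k, qs)) =
     (if Suc k = c
      then map_pmf (Pair 0) (seq_pmf (map (ddf_state F) ([] # butlast ((b @ [e]) # bs))))
      else map_pmf (Pair (Suc k)) (seq_pmf (map (ddf_state F) ((b @ [e]) # bs))))"
proof (cases "Suc k = c")
  case True
  let ?S = "seq_pmf (map (ddf_state F) ((b @ [e]) # bs))"
  have "bind_pmf (seq_pmf (map (ddf_state F) (b # bs))) (\<lambda>qs. queue_insert F c e (k, qs))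
      = do {q \<leftarrow> ddf_state F b; qs \<leftarrow> seq_pmf (map (ddf_state F) bs);
            q' \<leftarrow> ddf_insert F e q; fresh \<leftarrow> ddf_empty F;
            return_pmf (0, fresh # butlast (q' # qs))}"
    using True by (simp add: queue_insert_def bind_assoc_pmf bind_return_pmf del: butlast.simps)
  also have "\<dots> = do {q \<leftarrow> ddf_state F b; q' \<leftarrow> ddf_insert F e q;
            qs \<leftarrow> seq_pmf (map (ddf_state F) bs); fresh \<leftarrow> ddf_empty F;
            return_pmf (0, fresh # butlast (q' # qs))}"
    by (subst bind_commute_pmf) (rule refl)
  also have "\<dots> = do {qs \<leftarrow> ?S; fresh \<leftarrow> ddf_empty F; return_pmf (0, fresh # butlast qs)}"
    by (simp add: ddf_state_snoc bind_assoc_pmf bind_return_pmf)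
  also have "\<dots> = do {fresh \<leftarrow> ddf_empty F; qs \<leftarrow> map_pmf butlast ?S; return_pmf (0, fresh # qs)}"
    by (subst bind_commute_pmf) (simp add: bind_map_pmf)
  also have "\<dots> = map_pmf (Pair 0) (seq_pmf (map (ddf_state F) ([] # butlast ((b @ [e]) # bs))))"
    unfolding butlast_seq_pmf map_butlast[symmetric] by (simp add: ddf_state_Nil map_bind_pmf)
  finally show ?thesis
    using True by simp
next
  case False
  have "bind_pmf (seq_pmf (map (ddf_state F) (b # bs))) (\<lambda>qs. queue_insert F c e (k, qs))
      = do {q \<leftarrow> ddf_state F b; qs \<leftarrow> seq_pmf (map (ddf_state F) bs);
            q' \<leftarrow> ddf_insert F e q; return_pmf (Suc k, q' # qs)}"
    using False by (simp add: queue_insert_def bind_assoc_pmf bind_return_pmf)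
  also have "\<dots> = do {q \<leftarrow> ddf_state F b; q' \<leftarrow> ddf_insert F e q;
            qs \<leftarrow> seq_pmf (map (ddf_state F) bs); return_pmf (Suc k, q' # qs)}"
    by (subst bind_commute_pmf) (rule refl)
  also have "\<dots> = map_pmf (Pair (Suc k)) (seq_pmf (map (ddf_state F) ((b @ [e]) # bs)))"
    by (simp add: ddf_state_snoc bind_assoc_pmf map_bind_pmf)
  finally show ?thesis
    using False by simp
qed

text \<open>The invariant of the queue, by induction on the stream extended at its end. It gives
  independence for a fixed stream only; \<open>independent_answers\<close> concerns a random stream
  conditioned on a duplicate.\<close>

lemma queuing_filter_state:
  assumes "L \<ge> 1" "c \<ge> 1"
  shows "ddf_state (queuing_filter F L c) es =
    map_pmf (Pair (length es mod c)) (seq_pmf (map (\<lambda>i. ddf_state F (block c es i)) [0..<L]))"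
proof (induction es rule: rev_induct)
  case Nil
  have "map (\<lambda>i. ddf_state F (block c [] i)) [0..<L] = replicate L (ddf_empty F)"
    by (intro nth_equalityI) (auto simp: block_def ddf_state_Nil)
  then show ?case
    by (simp add: ddf_state_Nil queuing_filter_def seq_pmf_replicate)
next
  case (snoc e es)
  let ?k = "length es mod c"
  \<comment> \<open>Index 0 is split off, using \<open>L \<ge> 1\<close>, to match the cons form in
    \<open>queue_insert_seq_pmf\<close>.\<close>
  let ?bs = "map (block c es) [1..<L]"
  have L: "map (block c es) [0..<L] = block c es 0 # ?bs"
    using assms by (simp add: upt_conv_Cons)
  have "ddf_state (queuing_filter F L c) (es @ [e]) =
    bind_pmf (seq_pmf (map (ddf_state F) (map (block c es) [0..<L])))
      (\<lambda>qs. queue_insert F c e (?k, qs))"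
    using snoc by (simp add: ddf_state_snoc bind_map_pmf queuing_filter_def o_def)
  also have "\<dots> = (if Suc ?k = c
      then map_pmf (Pair 0) (seq_pmf (map (ddf_state F) ([] # butlast ((block c es 0 @ [e]) # ?bs))))
      else map_pmf (Pair (Suc ?k)) (seq_pmf (map (ddf_state F) ((block c es 0 @ [e]) # ?bs))))"
    unfolding L by (rule queue_insert_seq_pmf)
  also have "\<dots> = map_pmf (Pair (length (es @ [e]) mod c))
      (seq_pmf (map (ddf_state F) (map (block c (es @ [e])) [0..<L])))"
  proof (cases "Suc ?k = c")
    case True
    have "[] # butlast ((block c es 0 @ [e]) # ?bs) = map (block c (es @ [e])) [0..<L]"
    proof (rule nth_equalityI)
      fix i assume "i < length ([] # butlast ((block c es 0 @ [e]) # ?bs))"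
      then show "([] # butlast ((block c es 0 @ [e]) # ?bs)) ! i = map (block c (es @ [e])) [0..<L] ! i"
        using True assms block_snoc_full[of es c e]
        by (cases i) (auto simp: nth_butlast nth_Cons split: nat.split)
    qed (use assms in auto)
    moreover have "length (es @ [e]) mod c = 0"
      using True by (simp add: mod_Suc)
    ultimately show ?thesis
      using True by simp
  next
    case False
    moreover have "?k < c"
      using assms by simp
    ultimately have "Suc ?k < c" by simp
    have "(block c es 0 @ [e]) # ?bs = map (block c (es @ [e])) [0..<L]"
      using assms block_snoc[OF \<open>Suc ?k < c\<close>, of e] by (simp add: upt_conv_Cons)
    moreover have "length (es @ [e]) mod c = Suc ?k"
      using False by (simp add: mod_Suc)
    ultimately show ?thesis
      using False by simp
  qed
  finally show ?case
    by (simp add: o_def)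
qed

lemma queue_trial_eq:
  assumes "L \<ge> 1" "c \<ge> 1"
  shows "queue_trial F L c \<Gamma> m = do {
     es \<leftarrow> replicate_pmf m (pmf_of_set \<Gamma>);
     e \<leftarrow> pmf_of_set \<Gamma>;
     as \<leftarrow> seq_pmf (map (\<lambda>i. bind_pmf (ddf_state F (block c es i)) (ddf_lookup F e)) [0..<L]);
     return_pmf (es, e, as)}"
proof -
  have "do {(k, qs) \<leftarrow> ddf_state (queuing_filter F L c) es; as \<leftarrow> queue_lookups F e qs;
          return_pmf (es, e, as)}
      = do {as \<leftarrow> seq_pmf (map (\<lambda>i. bind_pmf (ddf_state F (block c es i)) (ddf_lookup F e)) [0..<L]);
          return_pmf (es, e, as)}" for es e
    using bind_seq_pmf[of "map (\<lambda>i. ddf_state F (block c es i)) [0..<L]" "ddf_lookup F e"]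
    by (simp add: queuing_filter_state[OF assms] bind_map_pmf queue_lookups_eq o_def
          flip: bind_assoc_pmf)
  then show ?thesis
    by (simp add: queue_trial_def)
qed

section \<open>Coincidence of the query with uniform samples\<close>

text \<open>\<open>1 - 1 / real (card \<Gamma>)\<close> is the probability that a uniform draw
  misses a given element. Its being strictly below 1 later makes the denominator of
  \<open>p_sub\<close> positive.\<close>

lemma miss_probability_bounds:
  fixes \<Gamma> :: "'a set"
  assumes "finite \<Gamma>" "\<Gamma> \<noteq> {}"
  shows "0 \<le> 1 - 1 / real (card \<Gamma>)" "1 - 1 / real (card \<Gamma>) < 1"
    and "0 \<le> (1 - 1 / real (card \<Gamma>)) ^ n" "(1 - 1 / real (card \<Gamma>)) ^ n \<le> 1"
proof -
  have "card \<Gamma> \<ge> 1"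
    using assms by (simp add: Suc_le_eq card_gt_0_iff)
  then show *: "0 \<le> 1 - 1 / real (card \<Gamma>)" "1 - 1 / real (card \<Gamma>) < 1"
    by (auto simp: field_simps)
  show "0 \<le> (1 - 1 / real (card \<Gamma>)) ^ n" "(1 - 1 / real (card \<Gamma>)) ^ n \<le> 1"
    using * by (auto intro!: zero_le_power power_le_one simp del: diff_ge_0_iff_ge)
qed

text \<open>All \<open>n\<close> independent draws must miss \<open>e\<close>; in the induction the
  disjunction of two independent coins fails with probability \<open>q * q ^ n\<close>. The
  parameter does not depend on \<open>e\<close>, which later decouples this event from the
  query.\<close>

lemma map_mem_replicate_pmf_of_set:
  assumes "finite \<Gamma>" "e \<in> \<Gamma>"
  shows "map_pmf (\<lambda>xs. e \<in> set xs) (replicate_pmf n (pmf_of_set \<Gamma>))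
    = bernoulli_pmf (1 - (1 - 1 / real (card \<Gamma>)) ^ n)"
proof (induction n)
  case 0
  show ?case
    by (rule pmf_eqI) (simp add: pmf_return bernoulli_pmf.rep_eq)
next
  case (Suc n)
  define q where "q = 1 - 1 / real (card \<Gamma>)"
  have "\<Gamma> \<noteq> {}"
    using assms by auto
  have q: "0 \<le> q" "q \<le> 1" and qn: "0 \<le> q ^ k" "q ^ k \<le> 1" for k
    using miss_probability_bounds[OF assms(1) \<open>\<Gamma> \<noteq> {}\<close>] by (simp_all add: q_def less_imp_le)
  have True: "pmf (map_pmf (\<lambda>x. e = x) (pmf_of_set \<Gamma>)) True = 1 - q"
    using assms pmf_of_set[OF \<open>\<Gamma> \<noteq> {}\<close> assms(1), of e] by (auto simp: pmf_map vimage_def measure_pmf_single q_def)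
  have hit: "map_pmf (\<lambda>x. e = x) (pmf_of_set \<Gamma>) = bernoulli_pmf (1 - q)" 
  proof (rule pmf_eqI)
    fix b
    show "pmf (map_pmf (\<lambda>x. e = x) (pmf_of_set \<Gamma>)) b = pmf (bernoulli_pmf (1 - q)) b"
      using True q by (cases b) (simp_all add: pmf_False_conv_True)
  qed
  have "map_pmf (\<lambda>xs. e \<in> set xs) (replicate_pmf (Suc n) (pmf_of_set \<Gamma>))
    = do {d \<leftarrow> map_pmf (\<lambda>x. e = x) (pmf_of_set \<Gamma>);
          d' \<leftarrow> map_pmf (\<lambda>xs. e \<in> set xs) (replicate_pmf n (pmf_of_set \<Gamma>)); return_pmf (d \<or> d')}"
    by (simp add: map_bind_pmf bind_map_pmf)
  also have "\<dots> = do {d \<leftarrow> bernoulli_pmf (1 - q); d' \<leftarrow> bernoulli_pmf (1 - q ^ n); return_pmf (d \<or> d')}"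
    unfolding hit Suc q_def[symmetric] ..
  also have "\<dots> = bernoulli_pmf (1 - q ^ Suc n)"
  proof (rule pmf_eqI)
    fix b
    show "pmf (do {d \<leftarrow> bernoulli_pmf (1 - q); d' \<leftarrow> bernoulli_pmf (1 - q ^ n); return_pmf (d \<or> d')}) b
      = pmf (bernoulli_pmf (1 - q ^ Suc n)) b"
      using q qn[of n] qn[of "Suc n"] 
      by (cases b) (simp_all add: pmf_bind measure_pmf_single algebra_simps)
  qed
  finally show ?case
    unfolding q_def .
qed

text \<open>The bounds on \<open>k\<close> place the block inside the window. The window elements
  outside it enter only through whether they contain \<open>e\<close>, which is the coin
  \<open>d\<close>.\<close>

lemma map_pmf_block_trial:
  assumes "finite \<Gamma>" "\<Gamma> \<noteq> {}" and k: "m - w \<le> k" "k + \<eta> \<le> m" "w \<le> m"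
  shows "map_pmf (\<lambda>(es, e, a). (a, window_duplicate w es e)) (do {
       es \<leftarrow> replicate_pmf m (pmf_of_set \<Gamma>);
       e \<leftarrow> pmf_of_set \<Gamma>;
       a \<leftarrow> bind_pmf (ddf_state F (take \<eta> (drop k es))) (ddf_lookup F e);
       return_pmf (es, e, a)})
    = do {d \<leftarrow> bernoulli_pmf (1 - (1 - 1 / real (card \<Gamma>)) ^ (w - \<eta>));
          (es, e, a) \<leftarrow> ddf_trial F \<Gamma> \<eta>;
          return_pmf (a, e \<in> set es \<or> d)}"
    (is "?lhs = ?rhs")
proof -
  let ?R = "\<lambda>n. replicate_pmf n (pmf_of_set \<Gamma>)"
  let ?A = "\<lambda>e b. bind_pmf (ddf_state F b) (ddf_lookup F e)"
  \<comment> \<open>Lengths of the stretches around the block: before the window, in the window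
    before the block, and after the block.\<close>
  define x y z where "x = m - w" and "y = k - (m - w)" and "z = m - (k + \<eta>)"
  have m: "m = x + (y + (\<eta> + z))" and w: "w - \<eta> = y + z"
    and window: "w = y + (\<eta> + z)" and k_eq: "k = x + y"
    using k by (auto simp: x_def y_def z_def)
  have R: "length xs = n" if "xs \<in> set_pmf (?R n)" for xs n
    using that by (auto simp: set_replicate_pmf)
  have wd: "window_duplicate w (xs @ ys @ bs @ zs) e \<longleftrightarrow> e \<in> set bs \<or> e \<in> set (ys @ zs)"
    and blk: "take \<eta> (drop k (xs @ ys @ bs @ zs)) = bs"
    if "xs \<in> set_pmf (?R x)" "ys \<in> set_pmf (?R y)" "bs \<in> set_pmf (?R \<eta>)" "zs \<in> set_pmf (?R z)"
    for xs ys bs zs e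
  proof -
    have "length xs = x" "length ys = y" "length bs = \<eta>" "length zs = z"
      using that R by auto
    then show "window_duplicate w (xs @ ys @ bs @ zs) e \<longleftrightarrow> e \<in> set bs \<or> e \<in> set (ys @ zs)"
      and "take \<eta> (drop k (xs @ ys @ bs @ zs)) = bs"
      by (auto simp: window_duplicate_def window k_eq)
  qed
  have "?lhs = do {xs \<leftarrow> ?R x; ys \<leftarrow> ?R y; bs \<leftarrow> ?R \<eta>; zs \<leftarrow> ?R z; e \<leftarrow> pmf_of_set \<Gamma>;
      a \<leftarrow> ?A e (take \<eta> (drop k (xs @ ys @ bs @ zs)));
      return_pmf (a, window_duplicate w (xs @ ys @ bs @ zs) e)}"
    unfolding m replicate_pmf_distrib
    by (simp add: bind_assoc_pmf bind_return_pmf map_bind_pmf)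
  also have "\<dots> = do {xs \<leftarrow> ?R x; ys \<leftarrow> ?R y; bs \<leftarrow> ?R \<eta>; zs \<leftarrow> ?R z; e \<leftarrow> pmf_of_set \<Gamma>;
      a \<leftarrow> ?A e bs; return_pmf (a, e \<in> set bs \<or> e \<in> set (ys @ zs))}"
    by (intro bind_pmf_cong refl) (simp_all only: wd blk)
  \<comment> \<open>The elements before the window no longer occur, so their draw
    disappears.\<close>
  also have "\<dots> = do {ys \<leftarrow> ?R y; bs \<leftarrow> ?R \<eta>; zs \<leftarrow> ?R z; e \<leftarrow> pmf_of_set \<Gamma>;
      a \<leftarrow> ?A e bs; return_pmf (a, e \<in> set bs \<or> e \<in> set (ys @ zs))}"
    by (simp only: bind_pmf_const)
  also have "\<dots> = do {bs \<leftarrow> ?R \<eta>; ys \<leftarrow> ?R y; zs \<leftarrow> ?R z; e \<leftarrow> pmf_of_set \<Gamma>;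
      a \<leftarrow> ?A e bs; return_pmf (a, e \<in> set bs \<or> e \<in> set (ys @ zs))}"
    by (rule bind_commute_pmf)
  \<comment> \<open>The two stretches now adjacent form one uniform sample of length
    \<open>y + z = w - \<eta>\<close>.\<close>
  also have "\<dots> = do {bs \<leftarrow> ?R \<eta>; us \<leftarrow> ?R (y + z); e \<leftarrow> pmf_of_set \<Gamma>;
      a \<leftarrow> ?A e bs; return_pmf (a, e \<in> set bs \<or> e \<in> set us)}"
    by (simp only: replicate_pmf_distrib bind_assoc_pmf bind_return_pmf)
  also have "\<dots> = do {bs \<leftarrow> ?R \<eta>; e \<leftarrow> pmf_of_set \<Gamma>; us \<leftarrow> ?R (y + z);
      a \<leftarrow> ?A e bs; return_pmf (a, e \<in> set bs \<or> e \<in> set us)}"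
    by (rule bind_pmf_cong[OF refl], rule bind_commute_pmf)
  also have "\<dots> = do {bs \<leftarrow> ?R \<eta>; e \<leftarrow> pmf_of_set \<Gamma>;
      d \<leftarrow> map_pmf (\<lambda>us. e \<in> set us) (?R (y + z));
      a \<leftarrow> ?A e bs; return_pmf (a, e \<in> set bs \<or> d)}"
    by (simp only: bind_map_pmf)
  \<comment> \<open>With \<open>e\<close> drawn first, membership in \<open>us\<close> is a coin
    whose parameter is free of \<open>e\<close> and \<open>bs\<close>; the coin can therefore be
    moved to the front.\<close>
  also have "\<dots> = do {bs \<leftarrow> ?R \<eta>; e \<leftarrow> pmf_of_set \<Gamma>;
      d \<leftarrow> bernoulli_pmf (1 - (1 - 1 / real (card \<Gamma>)) ^ (w - \<eta>));
      a \<leftarrow> ?A e bs; return_pmf (a, e \<in> set bs \<or> d)}"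
    using assms by (intro bind_pmf_cong refl) (simp add: map_mem_replicate_pmf_of_set w)
  also have "\<dots> = do {bs \<leftarrow> ?R \<eta>;
      d \<leftarrow> bernoulli_pmf (1 - (1 - 1 / real (card \<Gamma>)) ^ (w - \<eta>)); e \<leftarrow> pmf_of_set \<Gamma>;
      a \<leftarrow> ?A e bs; return_pmf (a, e \<in> set bs \<or> d)}"
    by (rule bind_pmf_cong[OF refl], rule bind_commute_pmf)
  also have "\<dots> = do {d \<leftarrow> bernoulli_pmf (1 - (1 - 1 / real (card \<Gamma>)) ^ (w - \<eta>)); bs \<leftarrow> ?R \<eta>;
      e \<leftarrow> pmf_of_set \<Gamma>; a \<leftarrow> ?A e bs; return_pmf (a, e \<in> set bs \<or> d)}"
    by (rule bind_commute_pmf)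
  also have "\<dots> = ?rhs"
    by (simp add: ddf_trial_def bind_assoc_pmf bind_return_pmf)
  finally show ?thesis .
qed

section \<open>Error probability of one block given a duplicate\<close>

lemma measure_bind_bernoulli_pmf:
  assumes "0 \<le> r" "r \<le> 1"
  shows "measure_pmf.prob (bind_pmf (bernoulli_pmf r) f) A
    = r * measure_pmf.prob (f True) A + (1 - r) * measure_pmf.prob (f False) A"
proof -
  have prob: "measure_pmf.prob p A = pmf (map_pmf (\<lambda>x. x \<in> A) p) True" for p
    by (simp add: pmf_map vimage_def)
  show ?thesis
    unfolding prob map_bind_pmf using assms by (simp add: pmf_bind algebra_simps)
qed

text \<open>The answer integrates out; drawing the query before the sample leaves a coin with the
  same parameter for every query.\<close>

lemma prob_mem_ddf_trial:
  assumes "finite \<Gamma>" "\<Gamma> \<noteq> {}"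
  shows "measure_pmf.prob (ddf_trial F \<Gamma> n) {(es, e, a). e \<in> set es}
    = 1 - (1 - 1 / real (card \<Gamma>)) ^ n"
proof -
  let ?q = "1 - 1 / real (card \<Gamma>)"
  have "map_pmf (\<lambda>(es, e, a). e \<in> set es) (ddf_trial F \<Gamma> n)
    = do {es \<leftarrow> replicate_pmf n (pmf_of_set \<Gamma>); e \<leftarrow> pmf_of_set \<Gamma>; return_pmf (e \<in> set es)}"
    by (simp add: ddf_trial_def map_bind_pmf)
  also have "\<dots> = do {e \<leftarrow> pmf_of_set \<Gamma>; map_pmf (\<lambda>es. e \<in> set es) (replicate_pmf n (pmf_of_set \<Gamma>))}"
    by (subst bind_commute_pmf) (simp add: map_pmf_def)
  also have "\<dots> = do {e \<leftarrow> pmf_of_set \<Gamma>; bernoulli_pmf (1 - ?q ^ n)}"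
    using assms by (intro bind_pmf_cong refl map_mem_replicate_pmf_of_set) auto
  finally have "map_pmf (\<lambda>(es, e, a). e \<in> set es) (ddf_trial F \<Gamma> n) = bernoulli_pmf (1 - ?q ^ n)"
    by simp
  then have "pmf (map_pmf (\<lambda>(es, e, a). e \<in> set es) (ddf_trial F \<Gamma> n)) True = 1 - ?q ^ n"
    using miss_probability_bounds(3,4)[OF assms] by simp
  moreover have "(\<lambda>(es, e, a). e \<in> set es) -` {True} = {(es, e :: 'a, a :: answer). e \<in> set es}"
    by auto
  ultimately show ?thesis
    by (simp add: pmf_map)
qed

text \<open>On heads, probability \<open>r\<close>, the query is a duplicate anyway and only the
  answer is constrained; on tails it must also lie in the block. \<open>A\<close> is arbitrary so
  that \<open>UNIV\<close> and \<open>{UNSEEN}\<close> yield denominator and numerator of the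
  conditional probability.\<close>

lemma prob_block_trial:
  assumes "finite \<Gamma>" "\<Gamma> \<noteq> {}" and k: "m - w \<le> k" "k + \<eta> \<le> m" "w \<le> m"
  defines "r \<equiv> 1 - (1 - 1 / real (card \<Gamma>)) ^ (w - \<eta>)"
  shows "measure_pmf.prob (do {
       es \<leftarrow> replicate_pmf m (pmf_of_set \<Gamma>);
       e \<leftarrow> pmf_of_set \<Gamma>;
       a \<leftarrow> bind_pmf (ddf_state F (take \<eta> (drop k es))) (ddf_lookup F e);
       return_pmf (es, e, a)}) {(es, e, a). a \<in> A \<and> window_duplicate w es e}
    = r * measure_pmf.prob (ddf_trial F \<Gamma> \<eta>) {(es, e, a). a \<in> A}
      + (1 - r) * measure_pmf.prob (ddf_trial F \<Gamma> \<eta>) {(es, e, a). a \<in> A \<and> e \<in> set es}"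
    (is "measure_pmf.prob ?X _ = _")
proof -
  have r: "0 \<le> r" "r \<le> 1"
    using miss_probability_bounds(3,4)[OF assms(1,2)] by (simp_all add: r_def)
  have "measure_pmf.prob ?X {(es, e, a). a \<in> A \<and> window_duplicate w es e}
    = measure_pmf.prob (map_pmf (\<lambda>(es, e, a). (a, window_duplicate w es e)) ?X) (A \<times> {True})"
    by (auto intro!: arg_cong[where f = "measure_pmf.prob ?X"])
  also have "\<dots> = measure_pmf.prob (do {d \<leftarrow> bernoulli_pmf r;
          map_pmf (\<lambda>(es, e, a). (a, e \<in> set es \<or> d)) (ddf_trial F \<Gamma> \<eta>)}) (A \<times> {True})"
    unfolding map_pmf_block_trial[OF assms(1-5)] r_def
    by (simp add: map_pmf_def case_prod_unfold)
  also have "\<dots> = r * measure_pmf.prob (ddf_trial F \<Gamma> \<eta>) {(es, e, a). a \<in> A}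
      + (1 - r) * measure_pmf.prob (ddf_trial F \<Gamma> \<eta>) {(es, e, a). a \<in> A \<and> e \<in> set es}"
    unfolding measure_bind_bernoulli_pmf[OF r] measure_map_pmf
    by (intro arg_cong2[where f = "(+)"] arg_cong2[where f = "(*)"]
          arg_cong[where f = "measure_pmf.prob _"] refl) auto
  finally show ?thesis .
qed

text \<open>With \<open>Q\<close>, \<open>R\<close> and \<open>W = Q * R\<close> the probabilities
  that the block, the rest of the window and the whole window miss the query, the quotient is
  \<open>(a1 + (1 - R) * a2) / (1 - W)\<close>. In it \<open>p_sub\<close> is the conditional
  probability that a duplicate lies in the block.\<close>

lemma
  assumes "finite \<Gamma>" "\<Gamma> \<noteq> {}" and k: "m - w \<le> k" "k + \<eta> \<le> m" "w \<le> m" and "0 < w" "\<eta> \<le> w"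
    and X_def: "X = do {
       es \<leftarrow> replicate_pmf m (pmf_of_set \<Gamma>);
       e \<leftarrow> pmf_of_set \<Gamma>;
       a \<leftarrow> bind_pmf (ddf_state F (take \<eta> (drop k es))) (ddf_lookup F e);
       return_pmf (es, e, a)}"
  shows prob_window_duplicate_block_trial:
      "measure_pmf.prob X {(es, e, a). window_duplicate w es e} > 0"
    and cond_prob_block_trial:
      "measure_pmf.prob X {(es, e, a). a = UNSEEN \<and> window_duplicate w es e}
        / measure_pmf.prob X {(es, e, a). window_duplicate w es e} = u_sub F \<Gamma> w \<eta>"
proof -
  let ?T = "ddf_trial F \<Gamma> \<eta>"
  define q where "q = 1 - 1 / real (card \<Gamma>)"
  define Q R W where "Q = q ^ \<eta>" and "R = q ^ (w - \<eta>)" and "W = q ^ w"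
  have q: "0 \<le> q" "q < 1"
    using miss_probability_bounds(1,2)[OF assms(1,2)] by (simp_all add: q_def)
  have W: "W = Q * R" "W < 1"
    using q \<open>\<eta> \<le> w\<close> \<open>0 < w\<close> power_less_one_iff[of q w]
    by (auto simp: W_def Q_def R_def simp flip: power_add)
  define a1 a2 b where "a1 = measure_pmf.prob ?T {(es, e, a). a = UNSEEN \<and> e \<in> set es}"
    and "a2 = measure_pmf.prob ?T {(es, e, a). a = UNSEEN \<and> e \<notin> set es}"
    and "b = measure_pmf.prob ?T {(es, e, a). a = DUPLICATE \<and> e \<notin> set es}"
  have mem: "measure_pmf.prob ?T {(es, e, a). e \<in> set es} = 1 - Q"
    using prob_mem_ddf_trial[OF assms(1,2)] by (simp add: Q_def q_def)
  have nmem: "measure_pmf.prob ?T {(es, e, a). e \<notin> set es} = Q"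
  proof -
    have "{(es, e, a). e \<notin> set es} = UNIV - {(es :: 'a list, e, a :: answer). e \<in> set es}"
      by auto
    then show ?thesis
      using measure_pmf.prob_compl[of "{(es, e, a). e \<in> set es}" ?T] mem by simp
  qed
  have "a2 + b = measure_pmf.prob ?T
      ({(es, e, a). a = UNSEEN \<and> e \<notin> set es} \<union> {(es, e, a). a = DUPLICATE \<and> e \<notin> set es})"
    unfolding a2_def b_def by (subst measure_pmf.finite_measure_Union) auto
  also have "{(es, e, a). a = UNSEEN \<and> e \<notin> set es} \<union> {(es, e, a). a = DUPLICATE \<and> e \<notin> set es}
      = {(es, e, a). e \<notin> set (es :: 'a list)}"
    using answer.exhaust by auto
  finally have a2b: "a2 + b = Q"
    unfolding nmem .
  have "a1 + a2 = measure_pmf.prob ?T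
      ({(es, e, a). a = UNSEEN \<and> e \<in> set es} \<union> {(es, e, a). a = UNSEEN \<and> e \<notin> set es})"
    unfolding a1_def a2_def by (subst measure_pmf.finite_measure_Union) auto
  \<comment> \<open>The trivial equations only fix the types of the components.\<close>
  also have "{(es, e, a). a = UNSEEN \<and> e \<in> set es} \<union> {(es, e, a). a = UNSEEN \<and> e \<notin> set es}
      = {(es, e, a). a = UNSEEN \<and> (e :: 'a) = e \<and> (es :: 'a list) = es}"
    by auto
  finally have a12: "measure_pmf.prob ?T {(es, e, a). a = UNSEEN} = a1 + a2"
    by simp
  have "a1 \<le> 1 - Q"
    unfolding a1_def mem[symmetric] by (rule measure_pmf.finite_measure_mono) auto
  have nonneg: "0 \<le> a1" "0 \<le> a2" "0 \<le> b"
    by (simp_all add: a1_def a2_def b_def)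
  have FN: "FN F \<Gamma> \<eta> = a1 / (1 - Q)"
    using mem by (simp add: FN_def cond_prob_def a1_def split_beta' case_prod_unfold)
  have FP: "FP F \<Gamma> \<eta> = b / Q"
    using nmem by (simp add: FP_def cond_prob_def b_def split_beta' case_prod_unfold)
  have "measure_pmf.prob X {(es, e, a). window_duplicate w es e}
      = (1 - R) + R * measure_pmf.prob ?T {(es, e, a). e \<in> set es}"
    using prob_block_trial[OF assms(1-5), of F UNIV]
    by (simp add: X_def q_def[symmetric] R_def[symmetric] case_prod_unfold)
  then have D: "measure_pmf.prob X {(es, e, a). window_duplicate w es e} = 1 - W"
    unfolding mem W by (simp add: algebra_simps)
  then show "measure_pmf.prob X {(es, e, a). window_duplicate w es e} > 0"
    using W by simp
  have U: "measure_pmf.prob X {(es, e, a). a = UNSEEN \<and> window_duplicate w es e} = a1 + (1 - R) * a2"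
    using prob_block_trial[OF assms(1-5), of F "{UNSEEN}"] a12
    by (simp add: X_def a1_def[symmetric] q_def[symmetric] R_def[symmetric] algebra_simps)
  have p: "p_sub \<Gamma> w \<eta> = (1 - Q) / (1 - W)"
    by (simp add: p_sub_def Q_def W_def q_def)
  then have p': "1 - p_sub \<Gamma> w \<eta> = Q * (1 - R) / (1 - W)"
    using W by (simp add: field_simps)
  \<comment> \<open>For an empty block \<open>Q = 1\<close> and \<open>FN\<close> is a division by
    zero, but then \<open>a1 \<le> 1 - Q\<close> forces \<open>a1 = 0\<close>.\<close>
  have "(1 - Q) * FN F \<Gamma> \<eta> = a1"
    using FN nonneg \<open>a1 \<le> 1 - Q\<close> by (cases "Q = 1") auto
  \<comment> \<open>\<open>Q = 0\<close> occurs for a one-letter alphabet and a nonempty block; then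
    \<open>a2 + b = Q\<close> forces \<open>a2 = 0\<close>.\<close>
  moreover have "Q * (1 - FP F \<Gamma> \<eta>) = a2"
    using FP nonneg a2b by (cases "Q = 0") (auto simp: field_simps)
  moreover have "u_sub F \<Gamma> w \<eta>
      = ((1 - Q) * FN F \<Gamma> \<eta> + (1 - R) * (Q * (1 - FP F \<Gamma> \<eta>))) / (1 - W)"
    unfolding u_sub_def p' unfolding p by (simp add: add_divide_distrib mult_ac)
  ultimately have "u_sub F \<Gamma> w \<eta> = (a1 + (1 - R) * a2) / (1 - W)"
    by simp
  then show "measure_pmf.prob X {(es, e, a). a = UNSEEN \<and> window_duplicate w es e}
      / measure_pmf.prob X {(es, e, a). window_duplicate w es e} = u_sub F \<Gamma> w \<eta>"
    using D U by simp
qed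

section \<open>From the queue to a single subfilter\<close>

text \<open>Positive probability ensures that \<open>B\<close> meets the support, without which
  \<open>cond_pmf\<close> is unspecified.\<close>

lemma measure_cond_pmf:
  assumes "measure_pmf.prob p B > 0"
  shows "measure_pmf.prob (cond_pmf p B) A = measure_pmf.prob p (A \<inter> B) / measure_pmf.prob p B"
proof -
  have "set_pmf p \<inter> B \<noteq> {}"
    using assms measure_Int_set_pmf[of p B] by (auto simp: Int_commute)
  then show ?thesis
    using assms
    by (simp add: cond_pmf.rep_eq measure_uniform_measure measure_pmf.emeasure_eq_measure Int_commute)
qed

text \<open>The other answers integrate out of the product. For \<open>i = 0\<close> only
  \<open>m mod c\<close> elements remain after the last complete block, which gives the two cases of
  \<open>\<eta>\<close>.\<close>

lemma map_nth_queue_trial: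
  assumes "c \<ge> 1" "i < L" "m > c * L"
  defines "\<eta> \<equiv> if i = 0 then m mod c else c"
  shows "map_pmf (\<lambda>(es, e, as). (es, e, as ! i)) (queue_trial F L c \<Gamma> m) = do {
       es \<leftarrow> replicate_pmf m (pmf_of_set \<Gamma>);
       e \<leftarrow> pmf_of_set \<Gamma>;
       a \<leftarrow> bind_pmf (ddf_state F (take \<eta> (drop ((m div c - i) * c) es))) (ddf_lookup F e);
       return_pmf (es, e, a)}"
proof -
  let ?A = "\<lambda>es e i. bind_pmf (ddf_state F (block c es i)) (ddf_lookup F e)"
  have "L \<ge> 1"
    using assms by simp
  have "map_pmf (\<lambda>(es, e, as). (es, e, as ! i)) (queue_trial F L c \<Gamma> m) = do {
       es \<leftarrow> replicate_pmf m (pmf_of_set \<Gamma>);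
       e \<leftarrow> pmf_of_set \<Gamma>;
       a \<leftarrow> map_pmf (\<lambda>as. as ! i) (seq_pmf (map (?A es e) [0..<L]));
       return_pmf (es, e, a)}"
    using \<open>L \<ge> 1\<close> assms by (simp add: queue_trial_eq map_bind_pmf bind_map_pmf)
  also have "\<dots> = do {es \<leftarrow> replicate_pmf m (pmf_of_set \<Gamma>); e \<leftarrow> pmf_of_set \<Gamma>;
       a \<leftarrow> ?A es e i; return_pmf (es, e, a)}"
    using assms by (simp add: nth_seq_pmf)
  also have "\<dots> = do {
       es \<leftarrow> replicate_pmf m (pmf_of_set \<Gamma>);
       e \<leftarrow> pmf_of_set \<Gamma>;
       a \<leftarrow> bind_pmf (ddf_state F (take \<eta> (drop ((m div c - i) * c) es))) (ddf_lookup F e);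
       return_pmf (es, e, a)}"
  proof (rule bind_pmf_cong[OF refl])
    fix es assume "es \<in> set_pmf (replicate_pmf m (pmf_of_set \<Gamma>))"
    then have "length es = m"
      by (simp add: set_replicate_pmf)
    \<comment> \<open>As \<open>m > c * L\<close>, the default \<open>[]\<close> of
      \<open>block\<close> does not arise.\<close>
    moreover have "i \<le> m div c"
      using assms by (simp add: less_eq_div_iff_mult_less_eq) 
        (metis less_imp_le_nat mult.commute mult_le_mono2 order_trans)
    moreover have "m - m div c * c = m mod c"
      by (simp add: minus_div_mult_eq_mod)
    moreover have "m mod c \<le> c"
      using assms by (simp add: less_imp_le_nat)
    ultimately have "block c es i = take \<eta> (drop ((m div c - i) * c) es)"
      by (auto simp: block_def \<eta>_def)
    then show "do {e \<leftarrow> pmf_of_set \<Gamma>; a \<leftarrow> ?A es e i; return_pmf (es, e, a)} = do {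
       e \<leftarrow> pmf_of_set \<Gamma>;
       a \<leftarrow> bind_pmf (ddf_state F (take \<eta> (drop ((m div c - i) * c) es))) (ddf_lookup F e);
       return_pmf (es, e, a)}"
      by simp
  qed
  finally show ?thesis .
qed

text \<open>Projecting to the \<open>i\<close>-th answer turns both events into events of the block
  trial, since being a duplicate depends only on the stream and the query.\<close>

lemma
  assumes "finite \<Gamma>" "\<Gamma> \<noteq> {}" "c \<ge> 1" "i < L" and w: "w = c * L" "m > w"
  shows prob_window_duplicate_queue_trial:
      "measure_pmf.prob (queue_trial F L c \<Gamma> m) {(es, e, as). window_duplicate w es e} > 0"
    and cond_prob_queue_trial:
      "measure_pmf.prob (cond_pmf (queue_trial F L c \<Gamma> m) {(es, e, as). window_duplicate w es e})
         {(es, e, as). as ! i = UNSEEN} = u_sub F \<Gamma> w (if i = 0 then m mod c else c)"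
proof -
  let ?M = "queue_trial F L c \<Gamma> m"
  let ?D = "{(es, e, as). window_duplicate w es e}"
  define \<eta> k where "\<eta> = (if i = 0 then m mod c else c)" and "k = (m div c - i) * c"
  define X where "X = do {
       es \<leftarrow> replicate_pmf m (pmf_of_set \<Gamma>);
       e \<leftarrow> pmf_of_set \<Gamma>;
       a \<leftarrow> bind_pmf (ddf_state F (take \<eta> (drop k es))) (ddf_lookup F e);
       return_pmf (es, e, a)}"
  have X: "X = map_pmf (\<lambda>(es, e, as). (es, e, as ! i)) ?M"
    using map_nth_queue_trial[of c i L m F \<Gamma>] assms by (simp add: X_def \<eta>_def k_def)
  have mc: "m div c * c + m mod c = m" "m mod c < c"
    using assms by auto
  have ic: "i * c + c \<le> w"
    using mult_le_mono1[of "Suc i" L c] assms by (simp add: mult.commute)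
  have k: "k = m div c * c - i * c"
    by (simp add: k_def diff_mult_distrib)
  \<comment> \<open>The block starts inside the window because \<open>i * c + c \<le> w\<close>
    while \<open>m mod c < c\<close>. For \<open>i > 0\<close> it ends by position \<open>m\<close>
    because \<open>c \<le> i * c\<close>.\<close>
  have bounds: "m - w \<le> k" "k + \<eta> \<le> m" "w \<le> m" "0 < w" "\<eta> \<le> w"
  proof -
    show "m - w \<le> k" "w \<le> m" "0 < w"
      using mc ic k w assms(3) by linarith+
    show "\<eta> \<le> w"
      using mc(2) ic by (auto simp: \<eta>_def)
    show "k + \<eta> \<le> m"
    proof (cases "i = 0")
      case True
      then show ?thesis
        using mc k by (simp add: \<eta>_def)
    next
      case False
      then have "c \<le> i * c" by simp
      then have "m div c * c - i * c + c \<le> m"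
        using mc(1) ic w(2) by linarith
      then show ?thesis
        using False by (simp add: \<eta>_def k)
    qed
  qed
  have D: "measure_pmf.prob X {(es, e, a). window_duplicate w es e} = measure_pmf.prob ?M ?D"
    unfolding X measure_map_pmf by (rule arg_cong[where f = "measure_pmf.prob _"]) auto
  have U: "measure_pmf.prob X {(es, e, a). a = UNSEEN \<and> window_duplicate w es e}
      = measure_pmf.prob ?M ({(es, e, as). as ! i = UNSEEN} \<inter> ?D)"
    unfolding X measure_map_pmf by (rule arg_cong[where f = "measure_pmf.prob _"]) auto
  show pos: "measure_pmf.prob ?M ?D > 0"
    using prob_window_duplicate_block_trial[OF assms(1,2) bounds X_def]
    unfolding D .
  show "measure_pmf.prob (cond_pmf ?M ?D) {(es, e, as). as ! i = UNSEEN}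
      = u_sub F \<Gamma> w (if i = 0 then m mod c else c)"
    using cond_prob_block_trial[OF assms(1,2) bounds X_def]
    unfolding D U measure_cond_pmf[OF pos] \<eta>_def[symmetric] .
qed

section \<open>Combining the subfilters\<close>

lemma ddf_trial_queuing_filter:
  "ddf_trial (queuing_filter F L c) \<Gamma> m =
     map_pmf (\<lambda>(es, e, as). (es, e, if DUPLICATE \<in> set as then DUPLICATE else UNSEEN))
       (queue_trial F L c \<Gamma> m)"
  by (simp add: ddf_trial_def queue_trial_def queuing_filter_def map_bind_pmf bind_map_pmf split_beta)

lemma length_queue_trial:
  assumes "L \<ge> 1" "c \<ge> 1" "(es, e, as) \<in> set_pmf (queue_trial F L c \<Gamma> m)"
  shows "length as = L"
  using assms by (auto simp: queue_trial_eq dest: length_seq_pmf)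

theorem theorem6:
  fixes F :: "('a, 's) ddf" and \<Gamma> :: "'a set" and L c w m :: nat
  assumes "finite \<Gamma>" and "\<Gamma> \<noteq> {}"
    and "L \<ge> 1" and "c \<ge> 1"
    and "w = c * L" and "m > w"
    and "independent_answers F L c \<Gamma> w m"
  shows "FN_window (queuing_filter F L c) \<Gamma> w m
           = u_sub F \<Gamma> w c ^ (L - 1) * u_sub F \<Gamma> w (m mod c)"
proof -
  let ?M = "queue_trial F L c \<Gamma> m"
  let ?D = "{(es, e, as). window_duplicate w es e}"
  let ?U = "\<lambda>i. {(es :: 'a list, e :: 'a, as). as ! i = UNSEEN}"
  have pos: "measure_pmf.prob ?M ?D > 0"
    using prob_window_duplicate_queue_trial[of \<Gamma> c 0 L w m F] assms by simp
  \<comment> \<open>The number of answers is known to be \<open>L\<close> only on the support, so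
    the two events are compared almost everywhere below.\<close>
  have all_unseen: "DUPLICATE \<notin> set as \<longleftrightarrow> (\<forall>i<L. as ! i = UNSEEN)"
    if "(es, e, as) \<in> set_pmf ?M" for es e as
  proof -
    have "DUPLICATE \<notin> set as \<longleftrightarrow> (\<forall>a\<in>set as. a = UNSEEN)"
      by (metis answer.distinct(1) answer.exhaust)
    then show ?thesis
      using length_queue_trial[OF assms(3,4) that] by (simp add: all_set_conv_all_nth)
  qed
  have "FN_window (queuing_filter F L c) \<Gamma> w m =
      measure_pmf.prob ?M {(es, e, as). DUPLICATE \<notin> set as \<and> window_duplicate w es e}
        / measure_pmf.prob ?M ?D"
    unfolding FN_window_def cond_prob_def ddf_trial_queuing_filter measure_map_pmf
    by (intro arg_cong2[where f = "(/)"] arg_cong[where f = "measure_pmf.prob ?M"]) auto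
  also have "measure_pmf.prob ?M {(es, e, as). DUPLICATE \<notin> set as \<and> window_duplicate w es e}
      = measure_pmf.prob ?M ((\<Inter>i\<in>{..<L}. ?U i) \<inter> ?D)"
    by (rule measure_pmf.finite_measure_eq_AE) (auto simp: AE_measure_pmf_iff dest: all_unseen)
  also have "\<dots> / measure_pmf.prob ?M ?D = measure_pmf.prob (cond_pmf ?M ?D) (\<Inter>i\<in>{..<L}. ?U i)"
    by (rule measure_cond_pmf[OF pos, symmetric])
  \<comment> \<open>The product rule of \<open>indep_events\<close> is applied to the full index
    set, which is nonempty because \<open>L \<ge> 1\<close>.\<close>
  also have "\<dots> = (\<Prod>i<L. measure_pmf.prob (cond_pmf ?M ?D) (?U i))"
    using assms(3,7) 
    unfolding independent_answers_def prob_space.indep_events_def[OF prob_space_measure_pmf]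
    by (auto simp: lessThan_empty_iff)
  also have "\<dots> = (\<Prod>i<L. u_sub F \<Gamma> w (if i = 0 then m mod c else c))"
    using assms by (intro prod.cong cond_prob_queue_trial) auto
  \<comment> \<open>The factor for \<open>i = 0\<close>, the partly filled newest subfilter, is
    split off; the other \<open>L - 1\<close> factors agree.\<close>
  also have "\<dots> = u_sub F \<Gamma> w c ^ (L - 1) * u_sub F \<Gamma> w (m mod c)"
    using assms(3) by (cases L) (simp_all add: prod.lessThan_Suc_shift del: prod.lessThan_Suc)
  finally show ?thesis .
qed

end
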